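(* Let $R$ be a ring, let $U$ be a uniserial right $R$-module, and let $S=\operatorname{End}_R(U)$. Let $$I=\{f\in S\mid f\text{ is not a monomorphism}\},\qquad K=\{f\in S\mid f\text{ is not an epimorphism}\}.$$ (i) Let $J$ be the trace of a projective right $S$-module. If $J\subseteq I$ then $J=0$. (ii) Let $L$ be the trace of a projective left $S$-module. If $L\subseteq K$ then $L=0$.
   Context: Rings are associative with $1$, not necessarily commutative. A module is uniserial if its submodules are totally ordered by inclusion. Elements of $S$ act on the left of $U$ and the product in $S$ is composition. The trace of a right (resp. left) $S$-module $M$ is the two-sided ideal $\operatorname{Tr}_S(M)=\sum_{h\in\operatorname{Hom}_S(M,S)}h(M)$ of $S$. *)

theory Defs
  imports "HOL-Algebra.Module"
begin

section \<open>Modules over rings that need not be commutative\<close>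

text \<open>
  The locale \<^locale>\<open>module\<close> requires a commutative ring, so only its record type and
  \<^locale>\<open>submodule\<close>, which makes no assumption on the ring, are reused.  For a right
  module the scalar is still written on the left: read \<open>a \<odot> x\<close> as \<open>x a\<close>.  The multiplicative
  fields of the record are irrelevant.
\<close>

locale left_module = R?: ring R + M?: abelian_group M
  for R (structure) and M :: "('a, 'm, 'c) module_scheme" (structure) +
  assumes smult_closed:
      "\<lbrakk>a \<in> carrier R; x \<in> carrier M\<rbrakk> \<Longrightarrow> a \<odot>\<^bsub>M\<^esub> x \<in> carrier M"
    and smult_l_distr:
      "\<lbrakk>a \<in> carrier R; b \<in> carrier R; x \<in> carrier M\<rbrakk> \<Longrightarrow>
        (a \<oplus> b) \<odot>\<^bsub>M\<^esub> x = a \<odot>\<^bsub>M\<^esub> x \<oplus>\<^bsub>M\<^esub> b \<odot>\<^bsub>M\<^esub> x"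
    and smult_r_distr:
      "\<lbrakk>a \<in> carrier R; x \<in> carrier M; y \<in> carrier M\<rbrakk> \<Longrightarrow>
        a \<odot>\<^bsub>M\<^esub> (x \<oplus>\<^bsub>M\<^esub> y) = a \<odot>\<^bsub>M\<^esub> x \<oplus>\<^bsub>M\<^esub> a \<odot>\<^bsub>M\<^esub> y"
    and smult_assoc:
      "\<lbrakk>a \<in> carrier R; b \<in> carrier R; x \<in> carrier M\<rbrakk> \<Longrightarrow>
        (a \<otimes> b) \<odot>\<^bsub>M\<^esub> x = a \<odot>\<^bsub>M\<^esub> (b \<odot>\<^bsub>M\<^esub> x)"
    and smult_one:
      "x \<in> carrier M \<Longrightarrow> \<one> \<odot>\<^bsub>M\<^esub> x = x"

locale right_module = R?: ring R + M?: abelian_group M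
  for R (structure) and M :: "('a, 'm, 'c) module_scheme" (structure) +
  assumes smult_closed:
      "\<lbrakk>a \<in> carrier R; x \<in> carrier M\<rbrakk> \<Longrightarrow> a \<odot>\<^bsub>M\<^esub> x \<in> carrier M"
    and smult_l_distr:
      "\<lbrakk>a \<in> carrier R; b \<in> carrier R; x \<in> carrier M\<rbrakk> \<Longrightarrow>
        (a \<oplus> b) \<odot>\<^bsub>M\<^esub> x = a \<odot>\<^bsub>M\<^esub> x \<oplus>\<^bsub>M\<^esub> b \<odot>\<^bsub>M\<^esub> x"
    and smult_r_distr:
      "\<lbrakk>a \<in> carrier R; x \<in> carrier M; y \<in> carrier M\<rbrakk> \<Longrightarrow>
        a \<odot>\<^bsub>M\<^esub> (x \<oplus>\<^bsub>M\<^esub> y) = a \<odot>\<^bsub>M\<^esub> x \<oplus>\<^bsub>M\<^esub> a \<odot>\<^bsub>M\<^esub> y"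
    and smult_assoc:
      "\<lbrakk>a \<in> carrier R; b \<in> carrier R; x \<in> carrier M\<rbrakk> \<Longrightarrow>
        (a \<otimes> b) \<odot>\<^bsub>M\<^esub> x = b \<odot>\<^bsub>M\<^esub> (a \<odot>\<^bsub>M\<^esub> x)"
    and smult_one:
      "x \<in> carrier M \<Longrightarrow> \<one> \<odot>\<^bsub>M\<^esub> x = x"

definition uniserial :: "('a, 'b) ring_scheme \<Rightarrow> ('a, 'm, 'c) module_scheme \<Rightarrow> bool" where
  "uniserial R M \<longleftrightarrow> (\<forall>A B. submodule A R M \<longrightarrow> submodule B R M \<longrightarrow> A \<subseteq> B \<or> B \<subseteq> A)"

definition mod_hom ::
    "('a, 'b) ring_scheme \<Rightarrow> ('a, 'm, 'c) module_scheme \<Rightarrow> ('a, 'n, 'd) module_scheme \<Rightarrow> ('m \<Rightarrow> 'n) set"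
  where
  "mod_hom R M N = {h \<in> hom (add_monoid M) (add_monoid N).
     \<forall>a\<in>carrier R. \<forall>x\<in>carrier M. h (a \<odot>\<^bsub>M\<^esub> x) = a \<odot>\<^bsub>N\<^esub> h x}"


section \<open>The endomorphism ring\<close>

text \<open>
  Endomorphisms are \<^const>\<open>extensional\<close>, so that equality in the ring is equality on the carrier
  of the module.
\<close>

definition end_ring :: "('a, 'b) ring_scheme \<Rightarrow> ('a, 'm, 'c) module_scheme \<Rightarrow> ('m \<Rightarrow> 'm) ring" where
  "end_ring R M =
    \<lparr>carrier = mod_hom R M M \<inter> extensional (carrier M),
     mult = (\<lambda>f g. compose (carrier M) f g),
     one = (\<lambda>x\<in>carrier M. x),
     zero = (\<lambda>x\<in>carrier M. \<zero>\<^bsub>M\<^esub>),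
     add = (\<lambda>f g. \<lambda>x\<in>carrier M. f x \<oplus>\<^bsub>M\<^esub> g x)\<rparr>"

definition non_mono_endos :: "('a, 'b) ring_scheme \<Rightarrow> ('a, 'm, 'c) module_scheme \<Rightarrow> ('m \<Rightarrow> 'm) set"
  where
  "non_mono_endos R M = {f \<in> carrier (end_ring R M). \<not> inj_on f (carrier M)}"

definition non_epi_endos :: "('a, 'b) ring_scheme \<Rightarrow> ('a, 'm, 'c) module_scheme \<Rightarrow> ('m \<Rightarrow> 'm) set"
  where
  "non_epi_endos R M = {f \<in> carrier (end_ring R M). f ` carrier M \<noteq> carrier M}"


section \<open>Projective modules\<close>

text \<open>
  Projectivity is the lifting property along surjective homomorphisms.  A definition cannot
  quantify over types, so the test modules \<open>A\<close>, \<open>B\<close> have carriers in fixed types.  These types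
  are large enough to contain the free module on the carrier of \<open>P\<close> and \<open>P\<close> itself, hence the
  lifting property follows for test modules over arbitrary types; this is proved below as
  \<open>projective_left_module_lift\<close> and \<open>projective_right_module_lift\<close>.
\<close>

definition projective_left_module :: "('a, 'b) ring_scheme \<Rightarrow> ('a, 'm) module \<Rightarrow> bool" where
  "projective_left_module R P \<longleftrightarrow> left_module R P \<and>
    (\<forall>(A :: ('a, 'm \<Rightarrow> 'a) module) (B :: ('a, 'm) module) g h.
      left_module R A \<longrightarrow> left_module R B \<longrightarrow>
      g \<in> mod_hom R A B \<longrightarrow> g ` carrier A = carrier B \<longrightarrow> h \<in> mod_hom R P B \<longrightarrow>
      (\<exists>k\<in>mod_hom R P A. \<forall>x\<in>carrier P. g (k x) = h x))"

definition projective_right_module :: "('a, 'b) ring_scheme \<Rightarrow> ('a, 'm) module \<Rightarrow> bool" where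
  "projective_right_module R P \<longleftrightarrow> right_module R P \<and>
    (\<forall>(A :: ('a, 'm \<Rightarrow> 'a) module) (B :: ('a, 'm) module) g h.
      right_module R A \<longrightarrow> right_module R B \<longrightarrow>
      g \<in> mod_hom R A B \<longrightarrow> g ` carrier A = carrier B \<longrightarrow> h \<in> mod_hom R P B \<longrightarrow>
      (\<exists>k\<in>mod_hom R P A. \<forall>x\<in>carrier P. g (k x) = h x))"


section \<open>The trace of a module\<close>

definition left_regular :: "('a, 'b) ring_scheme \<Rightarrow> ('a, 'a) module" where
  "left_regular S = \<lparr>carrier = carrier S, mult = mult S, one = one S, zero = zero S, add = add S,
     smult = (\<lambda>a x. a \<otimes>\<^bsub>S\<^esub> x)\<rparr>"

definition right_regular :: "('a, 'b) ring_scheme \<Rightarrow> ('a, 'a) module" where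
  "right_regular S = \<lparr>carrier = carrier S, mult = mult S, one = one S, zero = zero S, add = add S,
     smult = (\<lambda>a x. x \<otimes>\<^bsub>S\<^esub> a)\<rparr>"

text \<open>The sum of the images \<open>h(M)\<close> consists of the finite sums of elements, one from each image.\<close>

definition left_trace :: "('a, 'b) ring_scheme \<Rightarrow> ('a, 'm, 'c) module_scheme \<Rightarrow> 'a set" where
  "left_trace S M = {(\<Oplus>\<^bsub>S\<^esub>h\<in>H. y h) | H y.
     finite H \<and> H \<subseteq> mod_hom S M (left_regular S) \<and> (\<forall>h\<in>H. y h \<in> h ` carrier M)}"

definition right_trace :: "('a, 'b) ring_scheme \<Rightarrow> ('a, 'm, 'c) module_scheme \<Rightarrow> 'a set" where
  "right_trace S M = {(\<Oplus>\<^bsub>S\<^esub>h\<in>H. y h) | H y.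
     finite H \<and> H \<subseteq> mod_hom S M (right_regular S) \<and> (\<forall>h\<in>H. y h \<in> h ` carrier M)}"


section \<open>Basic facts\<close>

lemma left_module_left_regular:
  assumes "ring S"
  shows "left_module S (left_regular S)"
proof -
  interpret ring S by fact
  have "abelian_group (left_regular S)"
    by (rule abelian_groupI)
       (auto simp: left_regular_def a_ac intro: l_neg)
  then show ?thesis
    by (intro left_module.intro left_module_axioms.intro assms)
       (auto simp: left_regular_def l_distr r_distr m_assoc)
qed

lemma right_module_right_regular:
  assumes "ring S"
  shows "right_module S (right_regular S)"
proof -
  interpret ring S by fact
  have "abelian_group (right_regular S)"
    by (rule abelian_groupI)
       (auto simp: right_regular_def a_ac intro: l_neg)
  then show ?thesis
    by (intro right_module.intro right_module_axioms.intro assms)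
       (auto simp: right_regular_def l_distr r_distr m_assoc)
qed

lemma mod_homI:
  assumes "\<And>x. x \<in> carrier M \<Longrightarrow> h x \<in> carrier N"
    and "\<And>x y. \<lbrakk>x \<in> carrier M; y \<in> carrier M\<rbrakk> \<Longrightarrow> h (x \<oplus>\<^bsub>M\<^esub> y) = h x \<oplus>\<^bsub>N\<^esub> h y"
    and "\<And>a x. \<lbrakk>a \<in> carrier R; x \<in> carrier M\<rbrakk> \<Longrightarrow> h (a \<odot>\<^bsub>M\<^esub> x) = a \<odot>\<^bsub>N\<^esub> h x"
  shows "h \<in> mod_hom R M N"
  using assms by (auto simp: mod_hom_def hom_def)

lemma mod_homD:
  assumes "h \<in> mod_hom R M N"
  shows "\<And>x. x \<in> carrier M \<Longrightarrow> h x \<in> carrier N"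
    and "\<And>x y. \<lbrakk>x \<in> carrier M; y \<in> carrier M\<rbrakk> \<Longrightarrow> h (x \<oplus>\<^bsub>M\<^esub> y) = h x \<oplus>\<^bsub>N\<^esub> h y"
    and "\<And>a x. \<lbrakk>a \<in> carrier R; x \<in> carrier M\<rbrakk> \<Longrightarrow> h (a \<odot>\<^bsub>M\<^esub> x) = a \<odot>\<^bsub>N\<^esub> h x"
  using assms by (auto simp: mod_hom_def hom_def)

lemma mod_hom_zero:
  assumes "h \<in> mod_hom R M N" "abelian_group M" "abelian_group N"
  shows "h \<zero>\<^bsub>M\<^esub> = \<zero>\<^bsub>N\<^esub>"
proof -
  interpret M: abelian_group M by fact
  interpret N: abelian_group N by fact
  have "h \<zero>\<^bsub>M\<^esub> \<oplus>\<^bsub>N\<^esub> h \<zero>\<^bsub>M\<^esub> = h \<zero>\<^bsub>M\<^esub>"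
    using mod_homD(2)[OF assms(1), of "\<zero>\<^bsub>M\<^esub>" "\<zero>\<^bsub>M\<^esub>"] by simp
  then show ?thesis
    using mod_homD(1)[OF assms(1), of "\<zero>\<^bsub>M\<^esub>"] by simp
qed

lemma mod_hom_finsum:
  assumes "h \<in> mod_hom R M N" "abelian_group M" "abelian_group N"
    and "finite F" "t \<in> F \<rightarrow> carrier M"
  shows "h (\<Oplus>\<^bsub>M\<^esub>i\<in>F. t i) = (\<Oplus>\<^bsub>N\<^esub>i\<in>F. h (t i))"
proof -
  interpret M: abelian_group M by fact
  interpret N: abelian_group N by fact
  show ?thesis
    using assms(4,5)
  proof (induction rule: finite_induct)
    case empty
    then show ?case using mod_hom_zero[OF assms(1-3)] by simp
  next
    case (insert i F)
    then have *: "t \<in> F \<rightarrow> carrier M" "t i \<in> carrier M" by auto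
    then have "(\<lambda>i. h (t i)) \<in> F \<rightarrow> carrier N" "h (t i) \<in> carrier N"
      using mod_homD(1)[OF assms(1)] by auto
    then show ?case
      using insert * by (simp add: M.finsum_insert N.finsum_insert mod_homD(2)[OF assms(1)])
  qed
qed

lemma mod_hom_end_add:
  assumes "right_module R U" "f \<in> mod_hom R U U" "g \<in> mod_hom R U U"
  shows "(\<lambda>x\<in>carrier U. f x \<oplus>\<^bsub>U\<^esub> g x) \<in> mod_hom R U U"
proof -
  interpret right_module R U by fact
  show ?thesis
    by (rule mod_homI)
       (use assms(2,3) in \<open>auto simp: mod_homD smult_closed smult_r_distr M.a_ac\<close>)
qed

lemma mod_hom_end_neg:
  assumes "right_module R U" "f \<in> mod_hom R U U"
  shows "(\<lambda>x\<in>carrier U. \<ominus>\<^bsub>U\<^esub> f x) \<in> mod_hom R U U"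
proof -
  interpret right_module R U by fact
  have neg: "\<ominus>\<^bsub>U\<^esub> (a \<odot>\<^bsub>U\<^esub> x) = a \<odot>\<^bsub>U\<^esub> (\<ominus>\<^bsub>U\<^esub> x)"
    if "a \<in> carrier R" "x \<in> carrier U" for a x
  proof (rule M.minus_equality)
    have "a \<odot>\<^bsub>U\<^esub> \<zero>\<^bsub>U\<^esub> \<oplus>\<^bsub>U\<^esub> a \<odot>\<^bsub>U\<^esub> \<zero>\<^bsub>U\<^esub> = a \<odot>\<^bsub>U\<^esub> \<zero>\<^bsub>U\<^esub>"
      using that smult_r_distr[of a "\<zero>\<^bsub>U\<^esub>" "\<zero>\<^bsub>U\<^esub>"] by simp
    then have "a \<odot>\<^bsub>U\<^esub> \<zero>\<^bsub>U\<^esub> = \<zero>\<^bsub>U\<^esub>"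
      using that by (simp add: smult_closed)
    then show "a \<odot>\<^bsub>U\<^esub> (\<ominus>\<^bsub>U\<^esub> x) \<oplus>\<^bsub>U\<^esub> a \<odot>\<^bsub>U\<^esub> x = \<zero>\<^bsub>U\<^esub>"
      using that by (simp flip: smult_r_distr add: M.l_neg)
  qed (use that in \<open>auto simp: smult_closed\<close>)
  show ?thesis
    by (rule mod_homI)
       (use assms(2) in \<open>auto simp: mod_homD smult_closed neg M.minus_add\<close>)
qed

lemma mod_hom_end_compose:
  assumes "right_module R U" "f \<in> mod_hom R U U" "g \<in> mod_hom R U U"
  shows "compose (carrier U) f g \<in> mod_hom R U U"
proof -
  interpret right_module R U by fact
  show ?thesis
    by (rule mod_homI)
       (use assms(2,3) in \<open>auto simp: compose_def mod_homD smult_closed\<close>)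
qed

lemma ring_end_ring:
  assumes "right_module R U"
  shows "ring (end_ring R U)"
proof -
  interpret right_module R U by fact
  have zero: "(\<lambda>x\<in>carrier U. \<zero>\<^bsub>U\<^esub>) \<in> mod_hom R U U"
  proof (rule mod_homI)
    fix a x assume a: "a \<in> carrier R" and x: "x \<in> carrier U"
    have "a \<odot>\<^bsub>U\<^esub> \<zero>\<^bsub>U\<^esub> \<oplus>\<^bsub>U\<^esub> a \<odot>\<^bsub>U\<^esub> \<zero>\<^bsub>U\<^esub> = a \<odot>\<^bsub>U\<^esub> \<zero>\<^bsub>U\<^esub>"
      using a smult_r_distr[of a "\<zero>\<^bsub>U\<^esub>" "\<zero>\<^bsub>U\<^esub>"] by simp
    then have "a \<odot>\<^bsub>U\<^esub> \<zero>\<^bsub>U\<^esub> = \<zero>\<^bsub>U\<^esub>"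
      using a by (simp add: smult_closed)
    then show "(\<lambda>x\<in>carrier U. \<zero>\<^bsub>U\<^esub>) (a \<odot>\<^bsub>U\<^esub> x) = a \<odot>\<^bsub>U\<^esub> (\<lambda>x\<in>carrier U. \<zero>\<^bsub>U\<^esub>) x"
      using a x by (simp add: smult_closed)
  qed auto
  have one: "(\<lambda>x\<in>carrier U. x) \<in> mod_hom R U U"
    by (rule mod_homI) (auto simp: smult_closed)
  let ?S = "end_ring R U"
  have eqI: "f = g"
    if "f \<in> carrier ?S" "g \<in> carrier ?S" "\<And>x. x \<in> carrier U \<Longrightarrow> f x = g x" for f g
    using that by (auto simp: end_ring_def intro: extensionalityI)
  have app: "x \<in> carrier U \<Longrightarrow> (f \<oplus>\<^bsub>?S\<^esub> g) x = f x \<oplus>\<^bsub>U\<^esub> g x"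
    "x \<in> carrier U \<Longrightarrow> (f \<otimes>\<^bsub>?S\<^esub> g) x = f (g x)"
    "x \<in> carrier U \<Longrightarrow> \<zero>\<^bsub>?S\<^esub> x = \<zero>\<^bsub>U\<^esub>"
    "x \<in> carrier U \<Longrightarrow> \<one>\<^bsub>?S\<^esub> x = x" for f g x
    by (auto simp: end_ring_def compose_def)
  have closed: "f \<oplus>\<^bsub>?S\<^esub> g \<in> carrier ?S" "f \<otimes>\<^bsub>?S\<^esub> g \<in> carrier ?S"
    if "f \<in> carrier ?S" "g \<in> carrier ?S" for f g
    using that mod_hom_end_add[OF assms] mod_hom_end_compose[OF assms]
    by (auto simp: end_ring_def)
  have zero_one: "\<zero>\<^bsub>?S\<^esub> \<in> carrier ?S" "\<one>\<^bsub>?S\<^esub> \<in> carrier ?S"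
    using zero one by (auto simp: end_ring_def)
  have maps: "f x \<in> carrier U" "f (x \<oplus>\<^bsub>U\<^esub> y) = f x \<oplus>\<^bsub>U\<^esub> f y"
    if "f \<in> carrier ?S" "x \<in> carrier U" "y \<in> carrier U" for f x y
    using that by (auto simp: end_ring_def mod_homD)
  have neg: "\<exists>g\<in>carrier ?S. g \<oplus>\<^bsub>?S\<^esub> f = \<zero>\<^bsub>?S\<^esub>" if f: "f \<in> carrier ?S" for f
  proof
    show g: "(\<lambda>x\<in>carrier U. \<ominus>\<^bsub>U\<^esub> f x) \<in> carrier ?S"
      using f mod_hom_end_neg[OF assms] by (auto simp: end_ring_def)
    show "(\<lambda>x\<in>carrier U. \<ominus>\<^bsub>U\<^esub> f x) \<oplus>\<^bsub>?S\<^esub> f = \<zero>\<^bsub>?S\<^esub>"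
      by (rule eqI) (use f g in \<open>simp_all add: closed zero_one app maps M.l_neg\<close>)
  qed
  have "abelian_group ?S"
    by (rule abelian_groupI; (rule eqI)?) (simp_all add: closed zero_one app maps M.a_ac neg)
  moreover have "monoid ?S"
    by (rule monoidI; (rule eqI)?) (simp_all add: closed zero_one app maps)
  moreover have "ring_axioms ?S"
    by (rule ring_axioms.intro; rule eqI) (simp_all add: closed zero_one app maps)
  ultimately show ?thesis by (rule ring.intro)
qed


section \<open>The lifting property for test modules over arbitrary types\<close>

definition free_left_module :: "('a, 'b) ring_scheme \<Rightarrow> 'm set \<Rightarrow> ('a, 'm \<Rightarrow> 'a) module" where
  "free_left_module R X =
    \<lparr>carrier = {c. (\<forall>x. c x \<in> carrier R) \<and> finite {x. c x \<noteq> \<zero>\<^bsub>R\<^esub>} \<and> {x. c x \<noteq> \<zero>\<^bsub>R\<^esub>} \<subseteq> X},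
     mult = undefined, one = undefined,
     zero = (\<lambda>x. \<zero>\<^bsub>R\<^esub>), add = (\<lambda>c d x. c x \<oplus>\<^bsub>R\<^esub> d x), smult = (\<lambda>a c x. a \<otimes>\<^bsub>R\<^esub> c x)\<rparr>"

definition free_left_module_ext ::
    "('a, 'b) ring_scheme \<Rightarrow> ('a, 'n, 'c) module_scheme \<Rightarrow> ('m \<Rightarrow> 'n) \<Rightarrow> ('m \<Rightarrow> 'a) \<Rightarrow> 'n" where
  "free_left_module_ext R N t c = (\<Oplus>\<^bsub>N\<^esub>x\<in>{x. c x \<noteq> \<zero>\<^bsub>R\<^esub>}. c x \<odot>\<^bsub>N\<^esub> t x)"

lemma left_module_free_left_module:
  fixes R (structure)
  assumes "ring R"
  shows "left_module R (free_left_module R X)"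
proof -
  interpret ring R by fact
  let ?F = "free_left_module R X"
  have add: "c \<oplus>\<^bsub>?F\<^esub> d \<in> carrier ?F" if "c \<in> carrier ?F" "d \<in> carrier ?F" for c d
  proof -
    have sub: "{x. c x \<oplus> d x \<noteq> \<zero>} \<subseteq> {x. c x \<noteq> \<zero>} \<union> {x. d x \<noteq> \<zero>}" by (auto simp: that[unfolded free_left_module_def])
    then have "finite {x. c x \<oplus> d x \<noteq> \<zero>}"
      by (rule finite_subset) (use that in \<open>simp add: free_left_module_def\<close>)
    with sub show ?thesis
      using that unfolding free_left_module_def by simp blast
  qed
  have smult: "a \<odot>\<^bsub>?F\<^esub> c \<in> carrier ?F" if "a \<in> carrier R" "c \<in> carrier ?F" for a c
  proof -
    have sub: "{x. a \<otimes> c x \<noteq> \<zero>} \<subseteq> {x. c x \<noteq> \<zero>}" using that by (auto simp: free_left_module_def)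
    then have "finite {x. a \<otimes> c x \<noteq> \<zero>}"
      by (rule finite_subset) (use that in \<open>simp add: free_left_module_def\<close>)
    with sub show ?thesis
      using that unfolding free_left_module_def by simp blast
  qed
  have "abelian_group ?F"
  proof (rule abelian_groupI)
    fix c assume c: "c \<in> carrier ?F"
    have "(\<ominus> \<one>) \<odot>\<^bsub>?F\<^esub> c \<oplus>\<^bsub>?F\<^esub> c = \<zero>\<^bsub>?F\<^esub>"
      using c by (auto simp: free_left_module_def l_minus l_neg)
    then show "\<exists>d\<in>carrier ?F. d \<oplus>\<^bsub>?F\<^esub> c = \<zero>\<^bsub>?F\<^esub>"
      using smult[OF _ c] by blast
  qed (use add in \<open>auto simp: free_left_module_def a_ac\<close>)
  then show ?thesis
    by (intro left_module.intro left_module_axioms.intro assms)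
       (use smult in \<open>auto simp: free_left_module_def l_distr r_distr m_assoc\<close>)
qed

lemma free_left_module_ext_superset:
  assumes "left_module R N" "c \<in> carrier (free_left_module R X)" "t \<in> X \<rightarrow> carrier N"
    and "finite F" "{x. c x \<noteq> \<zero>\<^bsub>R\<^esub>} \<subseteq> F" "F \<subseteq> X"
  shows "free_left_module_ext R N t c = (\<Oplus>\<^bsub>N\<^esub>x\<in>F. c x \<odot>\<^bsub>N\<^esub> t x)"
proof -
  interpret left_module R N by fact
  have zero: "\<zero>\<^bsub>R\<^esub> \<odot>\<^bsub>N\<^esub> x = \<zero>\<^bsub>N\<^esub>" if "x \<in> carrier N" for x
  proof -
    have "\<zero>\<^bsub>R\<^esub> \<odot>\<^bsub>N\<^esub> x \<oplus>\<^bsub>N\<^esub> \<zero>\<^bsub>R\<^esub> \<odot>\<^bsub>N\<^esub> x = \<zero>\<^bsub>R\<^esub> \<odot>\<^bsub>N\<^esub> x"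
      using smult_l_distr[of "\<zero>\<^bsub>R\<^esub>" "\<zero>\<^bsub>R\<^esub>" x] that by simp
    then show ?thesis using that by (simp add: smult_closed)
  qed
  show ?thesis
    unfolding free_left_module_ext_def
    by (rule M.add.finprod_mono_neutral_cong_left)
       (use assms in \<open>auto simp: free_left_module_def zero Pi_def subset_iff intro!: smult_closed\<close>)
qed

lemma free_left_module_ext_hom:
  assumes "left_module R N" "t \<in> X \<rightarrow> carrier N"
  shows "free_left_module_ext R N t \<in> mod_hom R (free_left_module R X) N"
proof -
  interpret left_module R N by fact
  let ?F = "free_left_module R X"
  interpret F: left_module R ?F
    by (rule left_module_free_left_module) (rule R.ring_axioms)
  have supp: "finite {x. c x \<noteq> \<zero>\<^bsub>R\<^esub>}" "{x. c x \<noteq> \<zero>\<^bsub>R\<^esub>} \<subseteq> X" "c x \<in> carrier R"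
    if "c \<in> carrier ?F" for c x
    using that by (auto simp: free_left_module_def)
  have closed: "c x \<odot>\<^bsub>N\<^esub> t x \<in> carrier N" if "c \<in> carrier ?F" "x \<in> X" for c x
    using that assms(2) supp by (auto intro!: smult_closed)
  show ?thesis
  proof (rule mod_homI)
    fix c assume c: "c \<in> carrier ?F"
    then show "free_left_module_ext R N t c \<in> carrier N"
      unfolding free_left_module_ext_def
      using supp[OF c] closed[OF c] by (auto intro!: M.finsum_closed)
  next
    fix c d assume c: "c \<in> carrier ?F" and d: "d \<in> carrier ?F"
    let ?Y = "{x. c x \<noteq> \<zero>\<^bsub>R\<^esub>} \<union> {x. d x \<noteq> \<zero>\<^bsub>R\<^esub>}"
    have Y: "finite ?Y" "?Y \<subseteq> X" using supp c d by blast+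
    have cd: "c \<oplus>\<^bsub>?F\<^esub> d \<in> carrier ?F" using c d by (rule F.M.a_closed)
    have cd_eq: "(c \<oplus>\<^bsub>?F\<^esub> d) x = c x \<oplus>\<^bsub>R\<^esub> d x" for x by (simp add: free_left_module_def)
    then have sub: "{x. (c \<oplus>\<^bsub>?F\<^esub> d) x \<noteq> \<zero>\<^bsub>R\<^esub>} \<subseteq> ?Y" by auto
    have "free_left_module_ext R N t (c \<oplus>\<^bsub>?F\<^esub> d) = (\<Oplus>\<^bsub>N\<^esub>x\<in>?Y. (c \<oplus>\<^bsub>?F\<^esub> d) x \<odot>\<^bsub>N\<^esub> t x)"
      by (rule free_left_module_ext_superset[OF assms(1) cd assms(2) Y(1) sub Y(2)])
    also have "\<dots> = (\<Oplus>\<^bsub>N\<^esub>x\<in>?Y. c x \<odot>\<^bsub>N\<^esub> t x \<oplus>\<^bsub>N\<^esub> d x \<odot>\<^bsub>N\<^esub> t x)"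
    proof (rule M.finsum_cong')
      show "(\<lambda>x. c x \<odot>\<^bsub>N\<^esub> t x \<oplus>\<^bsub>N\<^esub> d x \<odot>\<^bsub>N\<^esub> t x) \<in> ?Y \<rightarrow> carrier N"
        using Y(2) closed c d by blast
      fix x assume "x \<in> ?Y"
      then have "t x \<in> carrier N" using Y(2) assms(2) by blast
      then show "(c \<oplus>\<^bsub>?F\<^esub> d) x \<odot>\<^bsub>N\<^esub> t x = c x \<odot>\<^bsub>N\<^esub> t x \<oplus>\<^bsub>N\<^esub> d x \<odot>\<^bsub>N\<^esub> t x"
        using supp(3) c d by (simp add: cd_eq smult_l_distr)
    qed simp
    also have "\<dots> = (\<Oplus>\<^bsub>N\<^esub>x\<in>?Y. c x \<odot>\<^bsub>N\<^esub> t x) \<oplus>\<^bsub>N\<^esub> (\<Oplus>\<^bsub>N\<^esub>x\<in>?Y. d x \<odot>\<^bsub>N\<^esub> t x)"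
      by (rule M.finsum_addf) (use Y(2) closed c d in blast)+
    also have "(\<Oplus>\<^bsub>N\<^esub>x\<in>?Y. c x \<odot>\<^bsub>N\<^esub> t x) = free_left_module_ext R N t c"
      by (rule free_left_module_ext_superset[OF assms(1) c assms(2) Y(1) _ Y(2), symmetric]) auto
    also have "(\<Oplus>\<^bsub>N\<^esub>x\<in>?Y. d x \<odot>\<^bsub>N\<^esub> t x) = free_left_module_ext R N t d"
      by (rule free_left_module_ext_superset[OF assms(1) d assms(2) Y(1) _ Y(2), symmetric]) auto
    finally show "free_left_module_ext R N t (c \<oplus>\<^bsub>?F\<^esub> d) =
      free_left_module_ext R N t c \<oplus>\<^bsub>N\<^esub> free_left_module_ext R N t d" .
  next
    fix a c assume a: "a \<in> carrier R" and c: "c \<in> carrier ?F"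
    let ?Y = "{x. c x \<noteq> \<zero>\<^bsub>R\<^esub>}"
    have ac: "a \<odot>\<^bsub>?F\<^esub> c \<in> carrier ?F" using a c by (rule F.smult_closed)
    have ac_eq: "(a \<odot>\<^bsub>?F\<^esub> c) x = a \<otimes>\<^bsub>R\<^esub> c x" for x by (simp add: free_left_module_def)
    then have sub: "{x. (a \<odot>\<^bsub>?F\<^esub> c) x \<noteq> \<zero>\<^bsub>R\<^esub>} \<subseteq> ?Y" using a by auto
    have t: "t x \<in> carrier N" if "x \<in> ?Y" for x using that supp(2)[OF c] assms(2) by blast
    have a_hom: "(\<lambda>x. a \<odot>\<^bsub>N\<^esub> x) \<in> mod_hom \<lparr>carrier = {}, mult = undefined, one = undefined,
        zero = undefined, add = undefined\<rparr> N N"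
      by (rule mod_homI) (use a in \<open>auto simp: smult_closed smult_r_distr\<close>)
    have "free_left_module_ext R N t (a \<odot>\<^bsub>?F\<^esub> c) = (\<Oplus>\<^bsub>N\<^esub>x\<in>?Y. (a \<odot>\<^bsub>?F\<^esub> c) x \<odot>\<^bsub>N\<^esub> t x)"
      by (rule free_left_module_ext_superset[OF assms(1) ac assms(2) supp(1)[OF c] sub supp(2)[OF c]])
    also have "\<dots> = (\<Oplus>\<^bsub>N\<^esub>x\<in>?Y. a \<odot>\<^bsub>N\<^esub> (c x \<odot>\<^bsub>N\<^esub> t x))"
      by (rule M.finsum_cong')
         (use a supp(3)[OF c] t in \<open>auto simp: ac_eq smult_assoc smult_closed\<close>)
    also have "\<dots> = a \<odot>\<^bsub>N\<^esub> free_left_module_ext R N t c"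
      unfolding free_left_module_ext_def
      by (rule mod_hom_finsum[OF a_hom M.abelian_group_axioms M.abelian_group_axioms supp(1)[OF c], symmetric])
         (use supp(3)[OF c] t in \<open>auto simp: smult_closed\<close>)
    finally show "free_left_module_ext R N t (a \<odot>\<^bsub>?F\<^esub> c) = a \<odot>\<^bsub>N\<^esub> free_left_module_ext R N t c" .
  qed
qed

theorem projective_left_module_lift:
  fixes P :: "('a, 'm) module"
    and A :: "('a, 'u, 'c) module_scheme" and B :: "('a, 'v, 'd) module_scheme"
  assumes P: "projective_left_module R P"
    and A: "left_module R A" and B: "left_module R B"
    and g: "g \<in> mod_hom R A B" "g ` carrier A = carrier B" and h: "h \<in> mod_hom R P B"
  shows "\<exists>k\<in>mod_hom R P A. \<forall>x\<in>carrier P. g (k x) = h x"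
proof -
  interpret P: left_module R P using P by (simp add: projective_left_module_def)
  interpret A: left_module R A by fact
  interpret B: left_module R B by fact
  let ?X = "carrier P" and ?F = "free_left_module R (carrier P)"
  let ?p = "free_left_module_ext R P (\<lambda>x. x)"
  have F: "left_module R ?F" by (rule left_module_free_left_module) (rule P.R.ring_axioms)
  have p: "?p \<in> mod_hom R ?F P"
    by (rule free_left_module_ext_hom) (auto intro: P.left_module_axioms)
  have p_surj: "?p ` carrier ?F = carrier P"
  proof
    show "?p ` carrier ?F \<subseteq> carrier P" using mod_homD(1)[OF p] by blast
    show "carrier P \<subseteq> ?p ` carrier ?F"
    proof
      fix x assume x: "x \<in> carrier P"
      let ?d = "\<lambda>y. if y = x then \<one>\<^bsub>R\<^esub> else \<zero>\<^bsub>R\<^esub>"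
      have "finite {y. ?d y \<noteq> \<zero>\<^bsub>R\<^esub>}" by (rule finite_subset[of _ "{x}"]) auto
      then have d: "?d \<in> carrier ?F" using x by (auto simp: free_left_module_def)
      have "?p ?d = (\<Oplus>\<^bsub>P\<^esub>y\<in>{x}. ?d y \<odot>\<^bsub>P\<^esub> y)"
        by (rule free_left_module_ext_superset[OF P.left_module_axioms d]) (use x in auto)
      also have "\<dots> = x" using x by (simp add: P.smult_one)
      finally show "x \<in> ?p ` carrier ?F" using d by (metis imageI)
    qed
  qed
  have "(\<lambda>x. x) \<in> mod_hom R P P" by (rule mod_homI) auto
  then obtain s where s: "s \<in> mod_hom R P ?F" "\<And>x. x \<in> carrier P \<Longrightarrow> ?p (s x) = x"
    using P F P.left_module_axioms p p_surj unfolding projective_left_module_def by metis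
  have "\<forall>x\<in>carrier P. \<exists>y\<in>carrier A. g y = h x"
    using g(2) mod_homD(1)[OF h] by (metis imageE)
  then obtain t where t: "\<And>x. x \<in> carrier P \<Longrightarrow> t x \<in> carrier A"
      "\<And>x. x \<in> carrier P \<Longrightarrow> g (t x) = h x"
    by metis
  let ?e = "free_left_module_ext R A t"
  have e: "?e \<in> mod_hom R ?F A" by (rule free_left_module_ext_hom[OF A]) (use t in auto)
  have "(\<lambda>x. ?e (s x)) \<in> mod_hom R P A"
    by (rule mod_homI) (auto simp: mod_homD[OF s(1)] mod_homD[OF e])
  moreover have "g (?e (s x)) = h x" if x: "x \<in> carrier P" for x
  proof -
    define c where "c = s x"
    have c: "c \<in> carrier ?F" using mod_homD(1)[OF s(1) x] by (simp add: c_def)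
    let ?Y = "{y. c y \<noteq> \<zero>\<^bsub>R\<^esub>}"
    have Y: "finite ?Y" "y \<in> ?Y \<Longrightarrow> y \<in> carrier P" "c y \<in> carrier R" for y
      using c by (auto simp: free_left_module_def)
    have "g (?e c) = (\<Oplus>\<^bsub>B\<^esub>y\<in>?Y. g (c y \<odot>\<^bsub>A\<^esub> t y))"
      unfolding free_left_module_ext_def
      by (rule mod_hom_finsum[OF g(1) A.M.abelian_group_axioms B.M.abelian_group_axioms Y(1)])
         (use Y t in \<open>auto intro!: A.smult_closed\<close>)
    also have "\<dots> = (\<Oplus>\<^bsub>B\<^esub>y\<in>?Y. h (c y \<odot>\<^bsub>P\<^esub> y))"
      by (rule B.M.finsum_cong')
         (use Y t in \<open>auto simp: mod_homD[OF g(1)] mod_homD[OF h] intro!: B.smult_closed\<close>)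
    also have "\<dots> = h (?p c)"
      unfolding free_left_module_ext_def
      by (rule mod_hom_finsum[OF h P.M.abelian_group_axioms B.M.abelian_group_axioms Y(1), symmetric])
         (use Y in \<open>auto intro!: P.smult_closed\<close>)
    finally show ?thesis using s(2)[OF x] by (simp add: c_def)
  qed
  ultimately show ?thesis by (intro bexI[where x = "\<lambda>x. ?e (s x)"]) auto
qed

definition opposite_ring :: "('a, 'b) ring_scheme \<Rightarrow> ('a, 'b) ring_scheme" where
  "opposite_ring R = R\<lparr>mult := (\<lambda>x y. y \<otimes>\<^bsub>R\<^esub> x)\<rparr>"

lemma opposite_ring_simps [simp]:
  "carrier (opposite_ring R) = carrier R" "one (opposite_ring R) = one R"
  "zero (opposite_ring R) = zero R" "add (opposite_ring R) = add R"
  "mult (opposite_ring R) x y = mult R y x"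
  "opposite_ring (opposite_ring R) = R"
  by (simp_all add: opposite_ring_def)

lemma ring_opposite_ring:
  assumes "ring R"
  shows "ring (opposite_ring R)"
proof -
  interpret ring R by fact
  have "abelian_group (opposite_ring R)"
    by (rule abelian_groupI) (auto simp: a_ac intro: l_neg)
  moreover have "monoid (opposite_ring R)"
    by (rule monoidI) (auto simp: m_assoc)
  ultimately show ?thesis
    by (intro ring.intro ring_axioms.intro) (auto simp: l_distr r_distr)
qed

lemma right_module_iff_left_module_opposite:
  "right_module R M \<longleftrightarrow> left_module (opposite_ring R) M"
proof -
  have "ring (opposite_ring R) \<longleftrightarrow> ring R"
    using ring_opposite_ring[of R] ring_opposite_ring[of "opposite_ring R"] by auto
  then show ?thesis
    by (auto simp: right_module_def left_module_def right_module_axioms_def left_module_axioms_def)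
qed

lemma mod_hom_opposite_ring [simp]: "mod_hom (opposite_ring R) M N = mod_hom R M N"
  by (simp add: mod_hom_def)

lemma projective_right_module_iff_opposite:
  "projective_right_module R P \<longleftrightarrow> projective_left_module (opposite_ring R) P"
  by (simp add: projective_right_module_def projective_left_module_def
      right_module_iff_left_module_opposite)

theorem projective_right_module_lift:
  fixes P :: "('a, 'm) module"
    and A :: "('a, 'u, 'c) module_scheme" and B :: "('a, 'v, 'd) module_scheme"
  assumes "projective_right_module R P"
    and "right_module R A" "right_module R B"
    and "g \<in> mod_hom R A B" "g ` carrier A = carrier B" "h \<in> mod_hom R P B"
  shows "\<exists>k\<in>mod_hom R P A. \<forall>x\<in>carrier P. g (k x) = h x"
  using assms projective_left_module_lift[of "opposite_ring R" P A B g h]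
  by (simp add: projective_right_module_iff_opposite right_module_iff_left_module_opposite)

end

theory Submission
  imports Defs
begin

text \<open>
  Let \<open>P\<close> be projective over \<open>S\<close> with trace \<open>T\<close>, and let \<open>(f\<^sub>y)\<close> be the coordinates of an element of
  \<open>P\<close> in a dual basis. Expanding the element and applying the functionals of the dual basis again
  shows that the finite vector \<open>(f\<^sub>y)\<close> is fixed by a square matrix with entries in \<open>T\<close>: a column
  \<open>f = E f\<close> if \<open>P\<close> is a right module, a row \<open>f = f E\<close> if it is a left module. If such vectors are
  all zero, then \<open>P = 0\<close> and hence \<open>T = 0\<close> (\<open>left_trace_eq_zeroI\<close>, \<open>right_trace_eq_zeroI\<close>; the second
  is the first over the opposite ring).

  For \<open>S = End(U)\<close> with \<open>U\<close> uniserial, fixed vectors of finite matrices vanish by comparing finite chains of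
  submodules. The two halves are dual to each other.

  \<^item> Suppose that no entry of \<open>E\<close> is a monomorphism and \<open>f = E f\<close>. The kernels of the entries form a
    finite chain, so their intersection \<open>K\<close> is one of them and is nonzero. The preimages
    \<open>f\<^sub>y\<^sup>-\<^sup>1(K)\<close> form a chain too; let the one at \<open>a\<close> be the smallest. On it every \<open>f\<^sub>y\<close> has values
    in \<open>K\<close>, which \<open>E\<close> kills, so every \<open>f\<^sub>y\<close> is zero there. Hence \<open>f\<^sub>a(U) \<inter> K = 0\<close>. Since \<open>K \<noteq> 0\<close> and
    \<open>U\<close> is uniserial, \<open>f\<^sub>a(U) \<subseteq> K\<close>: the smallest preimage is \<open>U\<close>, and \<open>f = 0\<close>.
  \<^item> Suppose that no entry of \<open>E\<close> is an epimorphism and \<open>f = f E\<close>. The sum \<open>V\<close> of the images of the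
    entries is one of them and is proper. Let \<open>f\<^sub>a(V)\<close> be the largest of the \<open>f\<^sub>y(V)\<close>. Then
    \<open>f\<^sub>y(U) \<subseteq> f\<^sub>a(V)\<close> for all \<open>y\<close>, in particular \<open>U = V + ker f\<^sub>a\<close>. Since \<open>V\<close> is proper and \<open>U\<close> is uniserial,
    \<open>V \<subseteq> ker f\<^sub>a\<close>, so \<open>f\<^sub>a(V) = 0\<close> and \<open>f = 0\<close>.
\<close>

section \<open>Traces of projective modules\<close>

lemma hom_image_in_left_trace:
  assumes "ring S" and h: "h \<in> mod_hom S P (left_regular S)" and x: "x \<in> carrier P"
  shows "h x \<in> left_trace S P"
proof -
  interpret ring S by fact
  have "h x \<in> carrier S"
    using mod_homD(1)[OF h x] by (simp add: left_regular_def)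
  then have "(\<Oplus>\<^bsub>S\<^esub>g\<in>{h}. g x) = h x"
    by simp
  then show ?thesis
    unfolding left_trace_def using h x by (intro CollectI exI[of _ "{h}"] exI[of _ "\<lambda>g. g x"]) auto
qed

lemma free_left_module_ext_id_surj:
  assumes "left_module R P"
  shows "free_left_module_ext R P (\<lambda>x. x) ` carrier (free_left_module R (carrier P)) = carrier P"
    (is "?p ` carrier ?F = _")
proof
  interpret P: left_module R P by fact
  have p: "?p \<in> mod_hom R ?F P"
    by (rule free_left_module_ext_hom) (auto intro: assms)
  show "?p ` carrier ?F \<subseteq> carrier P"
    using mod_homD(1)[OF p] by blast
  show "carrier P \<subseteq> ?p ` carrier ?F"
  proof
    fix x assume x: "x \<in> carrier P"
    let ?d = "\<lambda>y. if y = x then \<one>\<^bsub>R\<^esub> else \<zero>\<^bsub>R\<^esub>"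
    have "finite {y. ?d y \<noteq> \<zero>\<^bsub>R\<^esub>}" by (rule finite_subset[of _ "{x}"]) auto
    then have d: "?d \<in> carrier ?F" using x by (auto simp: free_left_module_def)
    have "?p ?d = (\<Oplus>\<^bsub>P\<^esub>y\<in>{x}. ?d y \<odot>\<^bsub>P\<^esub> y)"
      by (rule free_left_module_ext_superset[OF assms d]) (use x in auto)
    also have "\<dots> = x" using x by (simp add: P.smult_one)
    finally show "x \<in> ?p ` carrier ?F" using d by (metis imageI)
  qed
qed

text \<open>
  The dual basis is indexed by the elements of \<open>P\<close> themselves: its functionals are the coordinates of
  a splitting of the canonical map from the free module on \<open>carrier P\<close> onto \<open>P\<close>.
\<close>

lemma projective_dual_basis:
  fixes P :: "('a, 'm) module"
  assumes P: "projective_left_module S P"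
  obtains \<phi> where "\<And>y. \<phi> y \<in> mod_hom S P (left_regular S)"
    and "\<And>x. x \<in> carrier P \<Longrightarrow> finite {y. \<phi> y x \<noteq> \<zero>\<^bsub>S\<^esub>}"
    and "\<And>x. x \<in> carrier P \<Longrightarrow> {y. \<phi> y x \<noteq> \<zero>\<^bsub>S\<^esub>} \<subseteq> carrier P"
    and "\<And>x. x \<in> carrier P \<Longrightarrow> (\<Oplus>\<^bsub>P\<^esub>y\<in>{y. \<phi> y x \<noteq> \<zero>\<^bsub>S\<^esub>}. \<phi> y x \<odot>\<^bsub>P\<^esub> y) = x"
proof -
  interpret P: left_module S P using P by (simp add: projective_left_module_def)
  let ?F = "free_left_module S (carrier P)"
  have F: "left_module S ?F"
    by (rule left_module_free_left_module) (rule P.R.ring_axioms)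
  have p: "free_left_module_ext S P (\<lambda>x. x) \<in> mod_hom S ?F P"
    by (rule free_left_module_ext_hom) (auto intro: P.left_module_axioms)
  have "(\<lambda>x. x) \<in> mod_hom S P P" by (rule mod_homI) auto
  from projective_left_module_lift[OF P F P.left_module_axioms p
      free_left_module_ext_id_surj[OF P.left_module_axioms] this]
  obtain s where s: "s \<in> mod_hom S P ?F"
      "\<And>x. x \<in> carrier P \<Longrightarrow> free_left_module_ext S P (\<lambda>x. x) (s x) = x"
    by blast
  have sF: "s x \<in> carrier ?F" if "x \<in> carrier P" for x
    using mod_homD(1)[OF s(1) that] .
  show thesis
  proof (rule that[of "\<lambda>y x. s x y"])
    show "(\<lambda>x. s x y) \<in> mod_hom S P (left_regular S)" for y
    proof (rule mod_homI)
      show "s x y \<in> carrier (left_regular S)" if "x \<in> carrier P" for x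
        using sF[OF that] by (simp add: free_left_module_def left_regular_def)
    qed (simp_all add: mod_homD(2,3)[OF s(1)], simp_all add: free_left_module_def left_regular_def)
    show "finite {y. s x y \<noteq> \<zero>\<^bsub>S\<^esub>}" "{y. s x y \<noteq> \<zero>\<^bsub>S\<^esub>} \<subseteq> carrier P"
      if "x \<in> carrier P" for x
      using sF[OF that] by (simp_all add: free_left_module_def)
    show "(\<Oplus>\<^bsub>P\<^esub>y\<in>{y. s x y \<noteq> \<zero>\<^bsub>S\<^esub>}. s x y \<odot>\<^bsub>P\<^esub> y) = x" if "x \<in> carrier P" for x
      using s(2)[OF that] by (simp add: free_left_module_ext_def)
  qed
qed

text \<open>
  The matrix to which the hypothesis is applied is \<open>e y z = \<phi> z y\<close> for a dual basis \<open>\<phi>\<close>, and \<open>f\<close> is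
  the coordinate vector of an element \<open>x\<close>; the equation for \<open>f\<close> is \<open>\<phi> z\<close> applied to the expansion
  of \<open>x\<close>. The index set consists of the finitely many \<open>y\<close> at which \<open>x\<close> has a nonzero coordinate.
  If all coordinates vanish then \<open>x = 0\<close>, so \<open>P\<close> itself is zero.
\<close>

lemma left_trace_eq_zeroI:
  fixes P :: "('a, 'm) module"
  assumes P: "projective_left_module S P"
    and fixed_vector: "\<And>Y f e. \<lbrakk>finite Y; f \<in> Y \<rightarrow> carrier S;
        \<And>y z. \<lbrakk>y \<in> Y; z \<in> Y\<rbrakk> \<Longrightarrow> e y z \<in> left_trace S P;
        \<And>z. z \<in> Y \<Longrightarrow> f z = (\<Oplus>\<^bsub>S\<^esub>y\<in>Y. f y \<otimes>\<^bsub>S\<^esub> e y z)\<rbrakk>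
      \<Longrightarrow> \<forall>y\<in>(Y :: 'm set). f y = \<zero>\<^bsub>S\<^esub>"
  shows "left_trace S P = {\<zero>\<^bsub>S\<^esub>}"
proof -
  interpret P: left_module S P using P by (simp add: projective_left_module_def)
  interpret S: left_module S "left_regular S"
    by (rule left_module_left_regular) (rule P.R.ring_axioms)
  obtain \<phi> where \<phi>: "\<And>y. \<phi> y \<in> mod_hom S P (left_regular S)"
    "\<And>x. x \<in> carrier P \<Longrightarrow> finite {y. \<phi> y x \<noteq> \<zero>\<^bsub>S\<^esub>}"
    "\<And>x. x \<in> carrier P \<Longrightarrow> {y. \<phi> y x \<noteq> \<zero>\<^bsub>S\<^esub>} \<subseteq> carrier P"
    "\<And>x. x \<in> carrier P \<Longrightarrow> (\<Oplus>\<^bsub>P\<^esub>y\<in>{y. \<phi> y x \<noteq> \<zero>\<^bsub>S\<^esub>}. \<phi> y x \<odot>\<^bsub>P\<^esub> y) = x"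
    using projective_dual_basis[OF P] by blast
  have carr: "\<phi> y x \<in> carrier S" if "x \<in> carrier P" for y x
    using mod_homD(1)[OF \<phi>(1) that] by (simp add: left_regular_def)
  have zero: "x = \<zero>\<^bsub>P\<^esub>" if x: "x \<in> carrier P" for x
  proof -
    let ?Y = "{y. \<phi> y x \<noteq> \<zero>\<^bsub>S\<^esub>}"
    have "\<phi> z x = (\<Oplus>\<^bsub>S\<^esub>y\<in>?Y. \<phi> y x \<otimes>\<^bsub>S\<^esub> \<phi> z y)" for z
    proof -
      have "\<phi> z x = \<phi> z (\<Oplus>\<^bsub>P\<^esub>y\<in>?Y. \<phi> y x \<odot>\<^bsub>P\<^esub> y)"
        by (simp add: \<phi>(4)[OF x])
      also have "\<dots> = (\<Oplus>\<^bsub>left_regular S\<^esub>y\<in>?Y. \<phi> z (\<phi> y x \<odot>\<^bsub>P\<^esub> y))"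
        by (rule mod_hom_finsum[OF \<phi>(1) P.M.abelian_group_axioms S.M.abelian_group_axioms \<phi>(2)[OF x]])
           (use \<phi>(3)[OF x] carr[OF x] in \<open>auto intro!: P.smult_closed\<close>)
      also have "\<dots> = (\<Oplus>\<^bsub>S\<^esub>y\<in>?Y. \<phi> z (\<phi> y x \<odot>\<^bsub>P\<^esub> y))"
        by (simp add: finsum_def finprod_def left_regular_def)
      also have "\<dots> = (\<Oplus>\<^bsub>S\<^esub>y\<in>?Y. \<phi> y x \<otimes>\<^bsub>S\<^esub> \<phi> z y)"
      proof (rule P.R.finsum_cong')
        show "\<phi> z (\<phi> y x \<odot>\<^bsub>P\<^esub> y) = \<phi> y x \<otimes>\<^bsub>S\<^esub> \<phi> z y" if "y \<in> ?Y" for y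
        proof -
          have "y \<in> carrier P" using that \<phi>(3)[OF x] by blast
          then show ?thesis
            by (simp add: mod_homD(3)[OF \<phi>(1)] carr x) (simp add: left_regular_def)
        qed
      qed (use \<phi>(3)[OF x] carr x in auto)
      finally show ?thesis .
    qed
    moreover have "\<phi> z y \<in> left_trace S P" if "y \<in> ?Y" for y z
      by (rule hom_image_in_left_trace[OF P.R.ring_axioms \<phi>(1)]) (use that \<phi>(3)[OF x] in blast)
    ultimately have "\<forall>y\<in>?Y. \<phi> y x = \<zero>\<^bsub>S\<^esub>"
      by (intro fixed_vector[of ?Y "\<lambda>y. \<phi> y x" "\<lambda>y z. \<phi> z y", OF \<phi>(2)[OF x]] Pi_I carr[OF x])
    then have "?Y = {}" by blast
    then show ?thesis using \<phi>(4)[OF x] by simp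
  qed
  show ?thesis
  proof
    show "left_trace S P \<subseteq> {\<zero>\<^bsub>S\<^esub>}"
    proof
      fix t assume "t \<in> left_trace S P"
      then obtain H y where t: "t = (\<Oplus>\<^bsub>S\<^esub>h\<in>H. y h)" "H \<subseteq> mod_hom S P (left_regular S)"
          "\<forall>h\<in>H. y h \<in> h ` carrier P"
        unfolding left_trace_def by blast
      have "y h = \<zero>\<^bsub>S\<^esub>" if hH: "h \<in> H" for h
      proof -
        have h: "h \<in> mod_hom S P (left_regular S)" using hH t(2) by blast
        obtain x where x: "x \<in> carrier P" "y h = h x" using bspec[OF t(3) hH] by blast
        have "y h = h \<zero>\<^bsub>P\<^esub>" using x(2) zero[OF x(1)] by simp
        then show ?thesis
          using mod_hom_zero[OF h P.M.abelian_group_axioms S.M.abelian_group_axioms]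
          by (simp add: left_regular_def)
      qed
      then have "t = (\<Oplus>\<^bsub>S\<^esub>h\<in>H. \<zero>\<^bsub>S\<^esub>)"
        unfolding t(1) by (intro P.R.finsum_cong') auto
      then show "t \<in> {\<zero>\<^bsub>S\<^esub>}" by simp
    qed
    have "(\<Oplus>\<^bsub>S\<^esub>h\<in>{}. h \<zero>\<^bsub>P\<^esub>) \<in> left_trace S P"
      unfolding left_trace_def by (intro CollectI exI[of _ "{}"] exI[of _ "\<lambda>h. h \<zero>\<^bsub>P\<^esub>"]) auto
    then show "{\<zero>\<^bsub>S\<^esub>} \<subseteq> left_trace S P" by simp
  qed
qed

lemma right_trace_eq_opposite: "right_trace S P = left_trace (opposite_ring S) P"
  by (simp add: right_trace_def left_trace_def finsum_def finprod_def mod_hom_def hom_def left_regular_def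
      right_regular_def)

text \<open>
  Passing to the opposite ring reverses products, so the row vector becomes a column vector on which the
  matrix acts from the left.
\<close>

lemma right_trace_eq_zeroI:
  fixes P :: "('a, 'm) module"
  assumes P: "projective_right_module S P"
    and fixed_vector: "\<And>Y f e. \<lbrakk>finite Y; f \<in> Y \<rightarrow> carrier S;
        \<And>y z. \<lbrakk>y \<in> Y; z \<in> Y\<rbrakk> \<Longrightarrow> e y z \<in> right_trace S P;
        \<And>z. z \<in> Y \<Longrightarrow> f z = (\<Oplus>\<^bsub>S\<^esub>y\<in>Y. e y z \<otimes>\<^bsub>S\<^esub> f y)\<rbrakk>
      \<Longrightarrow> \<forall>y\<in>(Y :: 'm set). f y = \<zero>\<^bsub>S\<^esub>"
  shows "right_trace S P = {\<zero>\<^bsub>S\<^esub>}"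
proof -
  have finsum: "finsum (opposite_ring S) = finsum S"
    by (simp add: finsum_def finprod_def fun_eq_iff)
  have "left_trace (opposite_ring S) P = {\<zero>\<^bsub>opposite_ring S\<^esub>}"
  proof (rule left_trace_eq_zeroI)
    show "projective_left_module (opposite_ring S) P"
      using P by (simp add: projective_right_module_iff_opposite)
    fix Y :: "'m set" and f e
    assume "finite Y" "f \<in> Y \<rightarrow> carrier (opposite_ring S)"
      and e: "\<And>y z. \<lbrakk>y \<in> Y; z \<in> Y\<rbrakk> \<Longrightarrow> e y z \<in> left_trace (opposite_ring S) P"
      and fixed: "\<And>z. z \<in> Y \<Longrightarrow> f z = (\<Oplus>\<^bsub>opposite_ring S\<^esub>y\<in>Y. f y \<otimes>\<^bsub>opposite_ring S\<^esub> e y z)"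
    show "\<forall>y\<in>Y. f y = \<zero>\<^bsub>opposite_ring S\<^esub>"
      unfolding opposite_ring_simps
    proof (rule fixed_vector[of Y f e])
      show "f \<in> Y \<rightarrow> carrier S" using \<open>f \<in> Y \<rightarrow> carrier (opposite_ring S)\<close> by simp
      show "e y z \<in> right_trace S P" if "y \<in> Y" "z \<in> Y" for y z
        using e[OF that] by (simp only: right_trace_eq_opposite)
      show "f z = (\<Oplus>\<^bsub>S\<^esub>y\<in>Y. e y z \<otimes>\<^bsub>S\<^esub> f y)" if "z \<in> Y" for z
        using fixed[OF that] by (simp only: finsum opposite_ring_simps)
    qed fact
  qed
  then show ?thesis by (simp add: right_trace_eq_opposite)
qed


section \<open>Submodules and endomorphisms of a uniserial module\<close>

context right_module
begin

text \<open>Closure under negation follows from closure under scalars, as \<open>- x = x (- 1)\<close>.\<close>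

lemma submoduleI:
  assumes sub: "H \<subseteq> carrier M" and zero: "\<zero>\<^bsub>M\<^esub> \<in> H"
    and add: "\<And>x y. \<lbrakk>x \<in> H; y \<in> H\<rbrakk> \<Longrightarrow> x \<oplus>\<^bsub>M\<^esub> y \<in> H"
    and smult: "\<And>a x. \<lbrakk>a \<in> carrier R; x \<in> H\<rbrakk> \<Longrightarrow> a \<odot>\<^bsub>M\<^esub> x \<in> H"
  shows "submodule H R M"
proof -
  have neg: "\<ominus>\<^bsub>M\<^esub> x \<in> H" if "x \<in> H" for x
  proof -
    have x: "x \<in> carrier M" using that sub by blast
    have "\<zero>\<^bsub>R\<^esub> \<odot>\<^bsub>M\<^esub> x \<oplus>\<^bsub>M\<^esub> \<zero>\<^bsub>R\<^esub> \<odot>\<^bsub>M\<^esub> x = \<zero>\<^bsub>R\<^esub> \<odot>\<^bsub>M\<^esub> x"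
      using smult_l_distr[of "\<zero>\<^bsub>R\<^esub>" "\<zero>\<^bsub>R\<^esub>" x] x by simp
    then have "\<zero>\<^bsub>R\<^esub> \<odot>\<^bsub>M\<^esub> x = \<zero>\<^bsub>M\<^esub>" using x by (simp add: smult_closed)
    then have "(\<ominus>\<^bsub>R\<^esub> \<one>\<^bsub>R\<^esub>) \<odot>\<^bsub>M\<^esub> x \<oplus>\<^bsub>M\<^esub> x = \<zero>\<^bsub>M\<^esub>"
      using smult_l_distr[of "\<ominus>\<^bsub>R\<^esub> \<one>\<^bsub>R\<^esub>" "\<one>\<^bsub>R\<^esub>" x] x by (simp add: smult_one R.l_neg)
    then have "\<ominus>\<^bsub>M\<^esub> x = (\<ominus>\<^bsub>R\<^esub> \<one>\<^bsub>R\<^esub>) \<odot>\<^bsub>M\<^esub> x"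
      by (rule M.minus_equality) (use x in \<open>simp_all add: smult_closed\<close>)
    then show ?thesis using smult[of "\<ominus>\<^bsub>R\<^esub> \<one>\<^bsub>R\<^esub>" x] that by simp
  qed
  show ?thesis
    by (intro submodule.intro subgroup.intro submodule_axioms.intro)
       (use assms neg in \<open>simp_all flip: a_inv_def\<close>)
qed

lemma submoduleD:
  assumes "submodule H R M"
  shows "H \<subseteq> carrier M" "\<zero>\<^bsub>M\<^esub> \<in> H"
    "\<And>x y. \<lbrakk>x \<in> H; y \<in> H\<rbrakk> \<Longrightarrow> x \<oplus>\<^bsub>M\<^esub> y \<in> H"
    "\<And>a x. \<lbrakk>a \<in> carrier R; x \<in> H\<rbrakk> \<Longrightarrow> a \<odot>\<^bsub>M\<^esub> x \<in> H"
  using subgroup.subset[OF submodule.axioms(1)[OF assms]]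
    subgroup.one_closed[OF submodule.axioms(1)[OF assms]]
    subgroup.m_closed[OF submodule.axioms(1)[OF assms]]
    submodule.smult_closed[OF assms]
  by simp_all

lemma submodule_carrier: "submodule (carrier M) R M"
  by (rule submoduleI) (auto simp: smult_closed)

lemma smult_zero: "a \<in> carrier R \<Longrightarrow> a \<odot>\<^bsub>M\<^esub> \<zero>\<^bsub>M\<^esub> = \<zero>\<^bsub>M\<^esub>"
  using smult_r_distr[of a "\<zero>\<^bsub>M\<^esub>" "\<zero>\<^bsub>M\<^esub>"] smult_closed[of a "\<zero>\<^bsub>M\<^esub>"] by simp

lemma submodule_zero: "submodule {\<zero>\<^bsub>M\<^esub>} R M"
  by (rule submoduleI) (auto simp: smult_zero)

lemma endo_zero: "f \<in> mod_hom R M M \<Longrightarrow> f \<zero>\<^bsub>M\<^esub> = \<zero>\<^bsub>M\<^esub>"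
  by (rule mod_hom_zero[OF _ M.abelian_group_axioms M.abelian_group_axioms])

lemma submodule_image:
  assumes f: "f \<in> mod_hom R M M" and H: "submodule H R M"
  shows "submodule (f ` H) R M"
proof (rule submoduleI)
  note H = submoduleD[OF H]
  show "f ` H \<subseteq> carrier M" using H(1) mod_homD(1)[OF f] by blast
  show "\<zero>\<^bsub>M\<^esub> \<in> f ` H" using H(2) endo_zero[OF f] by force
  show "x \<oplus>\<^bsub>M\<^esub> y \<in> f ` H" if "x \<in> f ` H" "y \<in> f ` H" for x y
    using that H(1,3) mod_homD(2)[OF f] by (smt (verit) image_iff subsetD)
  show "a \<odot>\<^bsub>M\<^esub> x \<in> f ` H" if "a \<in> carrier R" "x \<in> f ` H" for a x
    using that H(1,4) mod_homD(3)[OF f] by (smt (verit) image_iff subsetD)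
qed

lemma submodule_preimage:
  assumes f: "f \<in> mod_hom R M M" and H: "submodule H R M"
  shows "submodule {x \<in> carrier M. f x \<in> H} R M"
  by (rule submoduleI)
     (use submoduleD[OF H] in \<open>auto simp: mod_homD[OF f] endo_zero[OF f] smult_closed\<close>)

lemma submodule_kernel:
  assumes "f \<in> mod_hom R M M"
  shows "submodule {x \<in> carrier M. f x = \<zero>\<^bsub>M\<^esub>} R M"
  using submodule_preimage[OF assms submodule_zero] by simp

lemma minus_add_cancel: "\<lbrakk>x \<in> carrier M; y \<in> carrier M\<rbrakk> \<Longrightarrow> (x \<ominus>\<^bsub>M\<^esub> y) \<oplus>\<^bsub>M\<^esub> y = x"
  by (simp add: a_minus_def M.a_assoc M.l_neg)

lemma endo_minus:
  assumes f: "f \<in> mod_hom R M M" and "x \<in> carrier M" "y \<in> carrier M" "f x = f y"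
  shows "f (x \<ominus>\<^bsub>M\<^esub> y) = \<zero>\<^bsub>M\<^esub>"
proof -
  have "f (x \<ominus>\<^bsub>M\<^esub> y) \<oplus>\<^bsub>M\<^esub> f y = f ((x \<ominus>\<^bsub>M\<^esub> y) \<oplus>\<^bsub>M\<^esub> y)"
    using assms by (simp add: mod_homD(2)[OF f])
  also have "\<dots> = f y"
    using assms by (simp add: minus_add_cancel)
  finally show ?thesis
    using assms by (simp add: mod_homD(1)[OF f])
qed

lemma non_injective_kernel:
  assumes f: "f \<in> mod_hom R M M" and "\<not> inj_on f (carrier M)"
  shows "\<exists>x\<in>carrier M. f x = \<zero>\<^bsub>M\<^esub> \<and> x \<noteq> \<zero>\<^bsub>M\<^esub>"
proof -
  obtain x y where xy: "x \<in> carrier M" "y \<in> carrier M" "f x = f y" "x \<noteq> y"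
    using assms(2) by (auto simp: inj_on_def)
  have "x \<ominus>\<^bsub>M\<^esub> y \<noteq> \<zero>\<^bsub>M\<^esub>"
    using minus_add_cancel[OF xy(1,2)] xy(2,4) by auto
  then show ?thesis
    using endo_minus[OF f xy(1-3)] xy(1,2) by blast
qed

lemma submodule_finsum:
  assumes H: "submodule H R M" and t: "\<And>i. i \<in> Y \<Longrightarrow> t i \<in> H"
  shows "(\<Oplus>\<^bsub>M\<^esub>i\<in>Y. t i) \<in> H"
proof -
  note H = submoduleD[OF H]
  show ?thesis
    using t
  proof (induction Y rule: infinite_finite_induct)
    case (insert i Y)
    then show ?case
      using H(1,3) by (subst M.finsum_insert) (auto simp: subset_iff)
  qed (use H(2) in auto)
qed

end

lemma finite_chain_has_least:
  assumes "finite I" "I \<noteq> {}" "\<And>i j. \<lbrakk>i \<in> I; j \<in> I\<rbrakk> \<Longrightarrow> A i \<subseteq> A j \<or> A j \<subseteq> A i"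
  shows "\<exists>i\<in>I. \<forall>j\<in>I. A i \<subseteq> A j"
proof -
  obtain i where i: "i \<in> I" "\<forall>b\<in>A ` I. b \<subseteq> A i \<longrightarrow> A i = b"
    using finite_has_minimal[of "A ` I"] assms(1,2) by auto
  have "A i \<subseteq> A j" if "j \<in> I" for j
    using assms(3)[OF i(1) that] i(2) that by blast
  then show ?thesis using i(1) by blast
qed

lemma finite_chain_has_greatest:
  assumes "finite I" "I \<noteq> {}" "\<And>i j. \<lbrakk>i \<in> I; j \<in> I\<rbrakk> \<Longrightarrow> A i \<subseteq> A j \<or> A j \<subseteq> A i"
  shows "\<exists>i\<in>I. \<forall>j\<in>I. A j \<subseteq> A i"
proof -
  obtain i where i: "i \<in> I" "\<forall>b\<in>A ` I. A i \<subseteq> b \<longrightarrow> A i = b"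
    using finite_has_maximal[of "A ` I"] assms(1,2) by auto
  have "A j \<subseteq> A i" if "j \<in> I" for j
    using assms(3)[OF i(1) that] i(2) that by blast
  then show ?thesis using i(1) by blast
qed


section \<open>Fixed vectors of matrices of endomorphisms\<close>

locale uniserial_module = right_module +
  assumes uniserial: "uniserial R M"
begin

lemma submodules_comparable:
  "\<lbrakk>submodule A R M; submodule B R M\<rbrakk> \<Longrightarrow> A \<subseteq> B \<or> B \<subseteq> A"
  using uniserial unfolding uniserial_def by blast

text \<open>
  The vector is zero wherever all its components lie in the common kernel \<open>K\<close> of the matrix entries.
  Because the preimages of \<open>K\<close> form a chain, this happens on the whole preimage under a single component
  \<open>f a\<close>, whose image therefore meets \<open>K\<close> only in zero; uniseriality excludes this unless \<open>f a\<close> maps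
  all of the module into \<open>K\<close>.
\<close>

lemma non_mono_matrix_fixed_column:
  assumes Y: "finite Y" and f: "\<And>y. y \<in> Y \<Longrightarrow> f y \<in> mod_hom R M M"
    and e: "\<And>y z. \<lbrakk>y \<in> Y; z \<in> Y\<rbrakk> \<Longrightarrow> e y z \<in> mod_hom R M M"
    and non_mono: "\<And>y z. \<lbrakk>y \<in> Y; z \<in> Y\<rbrakk> \<Longrightarrow> \<not> inj_on (e y z) (carrier M)"
    and fixed: "\<And>z u. \<lbrakk>z \<in> Y; u \<in> carrier M\<rbrakk> \<Longrightarrow> f z u = (\<Oplus>\<^bsub>M\<^esub>y\<in>Y. e y z (f y u))"
    and z: "z \<in> Y" and u: "u \<in> carrier M"
  shows "f z u = \<zero>\<^bsub>M\<^esub>"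
proof -
  define ker where "ker = (\<lambda>(y, z). {x \<in> carrier M. e y z x = \<zero>\<^bsub>M\<^esub>})"
  have ker: "submodule (ker p) R M" if "p \<in> Y \<times> Y" for p
    using that submodule_kernel[OF e] by (auto simp: ker_def)
  obtain p where p: "p \<in> Y \<times> Y" "\<And>q. q \<in> Y \<times> Y \<Longrightarrow> ker p \<subseteq> ker q"
    using finite_chain_has_least[of "Y \<times> Y" ker] Y z submodules_comparable[OF ker ker] by blast
  define K where "K = ker p"
  have K: "submodule K R M" using ker p(1) by (simp add: K_def)
  have K_kill: "e y z x = \<zero>\<^bsub>M\<^esub>" if "x \<in> K" "y \<in> Y" "z \<in> Y" for x y z
    using that p(2)[of "(y, z)"] by (auto simp: K_def ker_def)
  obtain y' z' where p_eq: "p = (y', z')" "y' \<in> Y" "z' \<in> Y" using p(1) by blast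
  obtain k where k: "k \<in> K" "k \<noteq> \<zero>\<^bsub>M\<^esub>"
    using non_injective_kernel[OF e non_mono, OF p_eq(2,3) p_eq(2,3)]
    by (auto simp: K_def ker_def p_eq(1))
  define A where "A = (\<lambda>y. {x \<in> carrier M. f y x \<in> K})"
  have A: "submodule (A y) R M" if "y \<in> Y" for y
    using submodule_preimage[OF f[OF that] K] by (simp add: A_def)
  obtain a where a: "a \<in> Y" "\<And>y. y \<in> Y \<Longrightarrow> A a \<subseteq> A y"
    using finite_chain_has_least[of Y A] Y z submodules_comparable[OF A A] by blast
  \<comment> \<open>Points of the smallest preimage lie in every preimage, so all components there have values in \<open>K\<close>.\<close>
  have A_zero: "f y x = \<zero>\<^bsub>M\<^esub>" if "x \<in> A a" "y \<in> Y" for x y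
  proof -
    have x: "x \<in> carrier M" using that by (simp add: A_def)
    have "f w x \<in> K" if "w \<in> Y" for w
      using a(2)[OF that] \<open>x \<in> A a\<close> by (auto simp: A_def)
    then have "(\<Oplus>\<^bsub>M\<^esub>w\<in>Y. e w y (f w x)) = (\<Oplus>\<^bsub>M\<^esub>w\<in>Y. \<zero>\<^bsub>M\<^esub>)"
      by (intro M.finsum_cong') (use \<open>y \<in> Y\<close> K_kill in auto)
    then show ?thesis using fixed[OF that(2) x] by simp
  qed
  \<comment> \<open>A nonzero \<open>k \<in> K\<close> of the form \<open>f a x\<close> would have \<open>x\<close> in the smallest preimage, forcing \<open>f a x = 0\<close>.\<close>
  have "\<not> K \<subseteq> f a ` carrier M"
  proof
    assume "K \<subseteq> f a ` carrier M"
    then obtain x where "x \<in> carrier M" "f a x = k" using k(1) by blast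
    then show False using A_zero[of x a] a(1) k by (simp add: A_def)
  qed
  then have "f a ` carrier M \<subseteq> K"
    using submodules_comparable[OF K submodule_image[OF f[OF a(1)] submodule_carrier]] by blast
  then show ?thesis using A_zero[of u z] u z by (auto simp: A_def)
qed

text \<open>
  The dual argument: a proper submodule of a uniserial module is superfluous, and the component \<open>f a\<close> with
  the largest image of \<open>V\<close> satisfies \<open>f a (U) = f a (V)\<close>, that is \<open>V + ker (f a) = U\<close>.
\<close>

lemma non_epi_matrix_fixed_row:
  assumes Y: "finite Y" and f: "\<And>y. y \<in> Y \<Longrightarrow> f y \<in> mod_hom R M M"
    and e: "\<And>y z. \<lbrakk>y \<in> Y; z \<in> Y\<rbrakk> \<Longrightarrow> e y z \<in> mod_hom R M M"
    and non_epi: "\<And>y z. \<lbrakk>y \<in> Y; z \<in> Y\<rbrakk> \<Longrightarrow> e y z ` carrier M \<noteq> carrier M"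
    and fixed: "\<And>z u. \<lbrakk>z \<in> Y; u \<in> carrier M\<rbrakk> \<Longrightarrow> f z u = (\<Oplus>\<^bsub>M\<^esub>y\<in>Y. f y (e y z u))"
    and z: "z \<in> Y" and u: "u \<in> carrier M"
  shows "f z u = \<zero>\<^bsub>M\<^esub>"
proof -
  define im where "im = (\<lambda>(y, z). e y z ` carrier M)"
  have im: "submodule (im p) R M" if "p \<in> Y \<times> Y" for p
    using that submodule_image[OF e submodule_carrier] by (auto simp: im_def)
  obtain p where p: "p \<in> Y \<times> Y" "\<And>q. q \<in> Y \<times> Y \<Longrightarrow> im q \<subseteq> im p"
    using finite_chain_has_greatest[of "Y \<times> Y" im] Y z submodules_comparable[OF im im] by blast
  define V where "V = im p"
  have V: "submodule V R M" using im p(1) by (simp add: V_def)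
  have V_im: "e y z x \<in> V" if "x \<in> carrier M" "y \<in> Y" "z \<in> Y" for x y z
    using that p(2)[of "(y, z)"] by (auto simp: V_def im_def)
  have V_proper: "V \<noteq> carrier M"
    using non_epi p(1) by (auto simp: V_def im_def)
  define A where "A = (\<lambda>y. f y ` V)"
  have A: "submodule (A y) R M" if "y \<in> Y" for y
    using submodule_image[OF f[OF that] V] by (simp add: A_def)
  obtain a where a: "a \<in> Y" "\<And>y. y \<in> Y \<Longrightarrow> A y \<subseteq> A a"
    using finite_chain_has_greatest[of Y A] Y z submodules_comparable[OF A A] by blast
  \<comment> \<open>The matrix maps into \<open>V\<close>, so every component of the row takes values in the largest image of \<open>V\<close>.\<close>
  have in_A: "f y x \<in> A a" if "x \<in> carrier M" "y \<in> Y" for x y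
    unfolding fixed[OF that(2,1)]
    by (rule submodule_finsum[OF A[OF a(1)]]) (use a(2) V_im that in \<open>unfold A_def, blast\<close>)
  \<comment> \<open>Otherwise \<open>V + ker (f a) = U\<close> would collapse to \<open>V = U\<close>.\<close>
  have "\<not> {x \<in> carrier M. f a x = \<zero>\<^bsub>M\<^esub>} \<subseteq> V"
  proof
    assume ker: "{x \<in> carrier M. f a x = \<zero>\<^bsub>M\<^esub>} \<subseteq> V"
    have "x \<in> V" if x: "x \<in> carrier M" for x
    proof -
      obtain v where v: "v \<in> V" "f a x = f a v"
        using in_A[OF x a(1)] by (auto simp: A_def)
      then have v': "v \<in> carrier M" using submoduleD(1)[OF V] by blast
      then have "x \<ominus>\<^bsub>M\<^esub> v \<in> V"
        using endo_minus[OF f[OF a(1)] x v' v(2)] ker x by auto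
      then have "(x \<ominus>\<^bsub>M\<^esub> v) \<oplus>\<^bsub>M\<^esub> v \<in> V" using v(1) submoduleD(3)[OF V] by blast
      then show ?thesis using x v' by (simp add: minus_add_cancel)
    qed
    then show False using V_proper submoduleD(1)[OF V] by blast
  qed
  then have "V \<subseteq> {x \<in> carrier M. f a x = \<zero>\<^bsub>M\<^esub>}"
    using submodules_comparable[OF V submodule_kernel[OF f[OF a(1)]]] by blast
  then have "A a \<subseteq> {\<zero>\<^bsub>M\<^esub>}" by (auto simp: A_def)
  then show ?thesis using in_A[OF u z] by blast
qed

end


section \<open>Traces over the endomorphism ring\<close>

lemma end_ring_finsum_apply:
  assumes "right_module R U" and g: "\<And>y. y \<in> Y \<Longrightarrow> g y \<in> carrier (end_ring R U)"
    and u: "u \<in> carrier U"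
  shows "(\<Oplus>\<^bsub>end_ring R U\<^esub>y\<in>Y. g y) u = (\<Oplus>\<^bsub>U\<^esub>y\<in>Y. g y u)"
proof -
  interpret right_module R U by fact
  interpret S: ring "end_ring R U" by (rule ring_end_ring) fact
  have apply_closed: "h u \<in> carrier U" if "h \<in> carrier (end_ring R U)" for h
    using that u by (auto simp: end_ring_def mod_homD)
  have zero: "\<zero>\<^bsub>end_ring R U\<^esub> u = \<zero>\<^bsub>U\<^esub>"
    using u by (simp add: end_ring_def)
  show ?thesis
    using g
  proof (induction Y rule: infinite_finite_induct)
    case (insert y Y)
    have "(\<Oplus>\<^bsub>end_ring R U\<^esub>y\<in>insert y Y. g y) u
        = (g y \<oplus>\<^bsub>end_ring R U\<^esub> (\<Oplus>\<^bsub>end_ring R U\<^esub>y\<in>Y. g y)) u"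
      using insert by (subst S.finsum_insert) auto
    also have "\<dots> = g y u \<oplus>\<^bsub>U\<^esub> (\<Oplus>\<^bsub>end_ring R U\<^esub>y\<in>Y. g y) u"
      using u by (simp add: end_ring_def)
    also have "\<dots> = (\<Oplus>\<^bsub>U\<^esub>y\<in>insert y Y. g y u)"
      using insert apply_closed by (subst M.finsum_insert) auto
    finally show ?case .
  qed (simp_all add: zero)
qed

lemma end_ring_eq_zeroI:
  assumes "f \<in> carrier (end_ring R U)" "\<And>u. u \<in> carrier U \<Longrightarrow> f u = \<zero>\<^bsub>U\<^esub>"
  shows "f = \<zero>\<^bsub>end_ring R U\<^esub>"
  using assms by (auto simp: end_ring_def intro!: extensionalityI[of f "carrier U"])

theorem corollary3p6:
  fixes R :: "('r, 'x) ring_scheme"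
    and U :: "('r, 'u, 'y) module_scheme"
    and P :: "('u \<Rightarrow> 'u, 'p) module"
    and Q :: "('u \<Rightarrow> 'u, 'q) module"
  assumes "ring R" and "right_module R U" and "uniserial R U"
  shows "(projective_right_module (end_ring R U) P \<longrightarrow>
           right_trace (end_ring R U) P \<subseteq> non_mono_endos R U \<longrightarrow>
           right_trace (end_ring R U) P = {\<zero>\<^bsub>end_ring R U\<^esub>})
       \<and> (projective_left_module (end_ring R U) Q \<longrightarrow>
           left_trace (end_ring R U) Q \<subseteq> non_epi_endos R U \<longrightarrow>
           left_trace (end_ring R U) Q = {\<zero>\<^bsub>end_ring R U\<^esub>})"
proof (intro conjI impI)
  let ?S = "end_ring R U"
  interpret U: uniserial_module R U
    using assms by (simp add: uniserial_module_def uniserial_module_axioms_def)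
  interpret S: ring ?S by (rule ring_end_ring) fact
  have hom: "g \<in> mod_hom R U U" if "g \<in> carrier ?S" for g
    using that by (simp add: end_ring_def)
  have mult_apply: "(g \<otimes>\<^bsub>?S\<^esub> h) u = g (h u)" if "u \<in> carrier U" for g h u
    using that by (simp add: end_ring_def compose_def)
  show "right_trace ?S P = {\<zero>\<^bsub>?S\<^esub>}"
    if P: "projective_right_module ?S P" and trace: "right_trace ?S P \<subseteq> non_mono_endos R U"
  proof (rule right_trace_eq_zeroI[OF P], rule ballI)
    fix Y :: "'p set" and f e w
    assume Y: "finite Y" and f: "f \<in> Y \<rightarrow> carrier ?S"
      and e: "\<And>y z. \<lbrakk>y \<in> Y; z \<in> Y\<rbrakk> \<Longrightarrow> e y z \<in> right_trace ?S P"
      and fixed: "\<And>z. z \<in> Y \<Longrightarrow> f z = (\<Oplus>\<^bsub>?S\<^esub>y\<in>Y. e y z \<otimes>\<^bsub>?S\<^esub> f y)" and w: "w \<in> Y"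
    have e': "e y z \<in> carrier ?S" "\<not> inj_on (e y z) (carrier U)" if "y \<in> Y" "z \<in> Y" for y z
      using e[OF that] trace by (auto simp: non_mono_endos_def)
    have f': "f y \<in> carrier ?S" if "y \<in> Y" for y using f that by blast
    show "f w = \<zero>\<^bsub>?S\<^esub>"
    proof (rule end_ring_eq_zeroI[OF f'[OF w]])
      fix u assume u: "u \<in> carrier U"
      show "f w u = \<zero>\<^bsub>U\<^esub>"
      proof (rule U.non_mono_matrix_fixed_column[where Y = Y and e = e and f = f and z = w and u = u])
        fix z u assume z: "z \<in> Y" and u: "u \<in> carrier U"
        have "f z u = (\<Oplus>\<^bsub>?S\<^esub>y\<in>Y. e y z \<otimes>\<^bsub>?S\<^esub> f y) u" using fixed[OF z] by simp
        also have "\<dots> = (\<Oplus>\<^bsub>U\<^esub>y\<in>Y. (e y z \<otimes>\<^bsub>?S\<^esub> f y) u)"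
          by (rule end_ring_finsum_apply[OF assms(2) _ u]) (use e' f' z in auto)
        finally show "f z u = (\<Oplus>\<^bsub>U\<^esub>y\<in>Y. e y z (f y u))" by (simp add: mult_apply u)
      qed (use Y w u e' f' hom in auto)
    qed
  qed
  show "left_trace ?S Q = {\<zero>\<^bsub>?S\<^esub>}"
    if Q: "projective_left_module ?S Q" and trace: "left_trace ?S Q \<subseteq> non_epi_endos R U"
  proof (rule left_trace_eq_zeroI[OF Q], rule ballI)
    fix Y :: "'q set" and f e w
    assume Y: "finite Y" and f: "f \<in> Y \<rightarrow> carrier ?S"
      and e: "\<And>y z. \<lbrakk>y \<in> Y; z \<in> Y\<rbrakk> \<Longrightarrow> e y z \<in> left_trace ?S Q"
      and fixed: "\<And>z. z \<in> Y \<Longrightarrow> f z = (\<Oplus>\<^bsub>?S\<^esub>y\<in>Y. f y \<otimes>\<^bsub>?S\<^esub> e y z)" and w: "w \<in> Y"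
    have e': "e y z \<in> carrier ?S" "e y z ` carrier U \<noteq> carrier U" if "y \<in> Y" "z \<in> Y" for y z
      using e[OF that] trace by (auto simp: non_epi_endos_def)
    have f': "f y \<in> carrier ?S" if "y \<in> Y" for y using f that by blast
    show "f w = \<zero>\<^bsub>?S\<^esub>"
    proof (rule end_ring_eq_zeroI[OF f'[OF w]])
      fix u assume u: "u \<in> carrier U"
      show "f w u = \<zero>\<^bsub>U\<^esub>"
      proof (rule U.non_epi_matrix_fixed_row[where Y = Y and e = e and f = f and z = w and u = u])
        fix z u assume z: "z \<in> Y" and u: "u \<in> carrier U"
        have "f z u = (\<Oplus>\<^bsub>?S\<^esub>y\<in>Y. f y \<otimes>\<^bsub>?S\<^esub> e y z) u" using fixed[OF z] by simp
        also have "\<dots> = (\<Oplus>\<^bsub>U\<^esub>y\<in>Y. (f y \<otimes>\<^bsub>?S\<^esub> e y z) u)"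
          by (rule end_ring_finsum_apply[OF assms(2) _ u]) (use e' f' z in auto)
        finally show "f z u = (\<Oplus>\<^bsub>U\<^esub>y\<in>Y. f y (e y z u))" by (simp add: mult_apply u)
      qed (use Y w u e' f' hom in auto)
    qed
  qed
qed

end
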